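(* Consider the system $\dot x=f(x)+g(x)u$, $x\in D\subseteq\mathbb{R}^n$, $u\in\mathbb{R}^m$. If $h,\hbar:D\to\mathbb{R}$ are CBFs and parallel, with $h(x)+\hbar(x)=b$ on $D$, $b>0$, then there exist extended class $\mathcal{K}_\infty$ functions $\alpha$ and $\overline{\alpha}$ such that the control law $$u^*=\begin{cases}u_0,&\text{if }L_gh(x)=0,\\ u_0,&\text{if }\underline{\eta}(x)\le L_gh(x)u_0\le\overline{\eta}(x),\\ u_0+(L_gh(x))^\top\dfrac{\overline{\eta}(x)-L_gh(x)u_0}{|L_gh(x)|^2},&\text{if }L_gh(x)u_0>\overline{\eta}(x),\\[2mm] u_0+(L_gh(x))^\top\dfrac{\underline{\eta}(x)-L_gh(x)u_0}{|L_gh(x)|^2},&\text{if }L_gh(x)u_0<\underline{\eta}(x),\end{cases}$$ where $$\underline{\eta}(x)=-L_fh(x)-\alpha(h(x)),\qquad \overline{\eta}(x)=-L_fh(x)+\overline{\alpha}(b-h(x)),$$ and $u_0$ is the nominal control, keeps the set $\mathcal{C}_h\cap\mathcal{C}_{\hbar}$ forward invariant.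
   Context: System: $\dot x=f(x)+g(x)u$ with $x\in D\subseteq\mathbb{R}^n$, $f:D\to\mathbb{R}^n$, $g:D\to\mathbb{R}^{n\times m}$, and unbounded input $u\in\mathbb{R}^m$. For continuously differentiable $h:D\to\mathbb{R}$, $L_fh(x)=\nabla h(x)^\top f(x)\in\mathbb{R}$ and $L_gh(x)=\nabla h(x)^\top g(x)$ (a $1\times m$ row vector). $|\cdot|$ is the Euclidean norm. $L_gh$ is allowed to vanish at some points; the first case in the control law takes precedence there. The nominal control $u_0$ is an arbitrary $\mathbb{R}^m$-valued signal (it may depend on the state and time). Extended class $\mathcal{K}_\infty$ function: a continuous strictly increasing $\alpha:\mathbb{R}\to\mathbb{R}$ with $\alpha(0)=0$ and $\alpha(s)\to\pm\infty$ as $s\to\pm\infty$. Barrier function candidate: a continuously differentiable $h:D\to\mathbb{R}$ with $\inf_D h<0<\sup_D h$. Safe sets: $\mathcal{C}_h=\{x\in D\mid h(x)\ge0\}$, $\mathcal{C}_{\hbar}=\{x\in D\mid \hbar(x)\ge0\}$. Control Barrier Function (CBF): a continuously differentiable $h:D\to\mathbb{R}$ such that for some extended class $\mathcal{K}_\infty$ function $\alpha$, $\sup_{u\in\mathbb{R}^m}[L_fh(x)+L_gh(x)u]\ge-\alpha(h(x))$ for all $x\in D$; since $u$ is unbounded this is equivalent to: $L_gh(x)=0\implies L_fh(x)\ge-\alpha(h(x))$. Parallel: a pair of candidates $h,\hbar$ is parallel if there is a constant $b>0$ with $h(x)+\hbar(x)=b$ for all $x\in D$. Forward invariance of a set $\mathcal{C}\subseteq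 D$: every closed-loop solution $x:[t_0,\infty)\to D$ (a differentiable function satisfying $\dot x(t)=f(x(t))+g(x(t))u^*(t)$ for all $t\ge t_0$, where $u^*(t)$ is the control law evaluated along the solution) with $x(t_0)\in\mathcal{C}$ satisfies $x(t)\in\mathcal{C}$ for all $t\in[t_0,\infty)$. *)

theory Defs
  imports "HOL-Analysis.Analysis"
begin

definition ext_class_K_inf :: "(real \<Rightarrow> real) \<Rightarrow> bool" where
  "ext_class_K_inf \<alpha> \<longleftrightarrow> continuous_on UNIV \<alpha> \<and> strict_mono \<alpha> \<and> \<alpha> 0 = 0 \<and>
     filterlim \<alpha> at_top at_top \<and> filterlim \<alpha> at_bot at_bot"

definition is_grad :: "(real^'n) set \<Rightarrow> (real^'n \<Rightarrow> real) \<Rightarrow> real^'n \<Rightarrow> real^'n \<Rightarrow> bool" where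
  "is_grad D h x d \<longleftrightarrow> (h has_derivative (\<lambda>v. d \<bullet> v)) (at x within D)"

definition grad :: "(real^'n) set \<Rightarrow> (real^'n \<Rightarrow> real) \<Rightarrow> real^'n \<Rightarrow> real^'n" where
  "grad D h x = (THE d. is_grad D h x d)"

text \<open>The domain \<open>D\<close> is an arbitrary set, and functions on \<open>D\<close> are total functions whose values
  outside \<open>D\<close> are irrelevant. Derivatives are therefore taken within \<open>D\<close>, and continuous
  differentiability includes that the gradient is well defined, i.e. unique, at each point of \<open>D\<close>.
  For open \<open>D\<close> uniqueness is automatic; see \<open>C1_on_open_iff\<close> below.\<close>

definition C1_on :: "(real^'n) set \<Rightarrow> (real^'n \<Rightarrow> real) \<Rightarrow> bool" where
  "C1_on D h \<longleftrightarrow> (\<forall>x\<in>D. \<exists>!d. is_grad D h x d) \<and> continuous_on D (grad D h)"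

lemma is_grad_open_iff:
  assumes "open D" "x \<in> D"
  shows "is_grad D h x d \<longleftrightarrow> GDERIV h x :> d"
  unfolding is_grad_def gderiv_def at_within_open[OF assms(2,1)] inner_commute[of d] ..

lemma is_grad_open_unique:
  assumes "open D" "x \<in> D" "is_grad D h x d" "is_grad D h x e"
  shows "d = e"
proof -
  have "(\<lambda>v. d \<bullet> v) = (\<lambda>v. e \<bullet> v)"
    using assms(3,4) unfolding is_grad_def at_within_open[OF assms(2,1)]
    by (rule has_derivative_unique)
  then show ?thesis
    using vector_eq_rdot[of d e] by (simp add: fun_eq_iff)
qed

lemma C1_on_open_iff:
  assumes "open D"
  shows "C1_on D h \<longleftrightarrow> (\<exists>G. continuous_on D G \<and> (\<forall>x\<in>D. GDERIV h x :> G x))"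
proof
  assume c: "C1_on D h"
  have "is_grad D h x (grad D h x)" if "x \<in> D" for x
    unfolding grad_def by (rule theI') (use c that in \<open>simp add: C1_on_def\<close>)
  then show "\<exists>G. continuous_on D G \<and> (\<forall>x\<in>D. GDERIV h x :> G x)"
    using c assms by (auto simp: C1_on_def is_grad_open_iff)
next
  assume "\<exists>G. continuous_on D G \<and> (\<forall>x\<in>D. GDERIV h x :> G x)"
  then obtain G where G: "continuous_on D G" "\<And>x. x \<in> D \<Longrightarrow> is_grad D h x (G x)"
    using assms by (auto simp: is_grad_open_iff)
  have u: "\<exists>!d. is_grad D h x d" if "x \<in> D" for x
    using G(2)[OF that] is_grad_open_unique[OF assms that] by blast
  have "grad D h x = G x" if "x \<in> D" for x
    unfolding grad_def by (rule the1_equality[OF u[OF that] G(2)[OF that]])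
  then have "continuous_on D (grad D h)"
    using G(1) continuous_on_cong[OF refl, of D "grad D h" G] by blast
  with u show "C1_on D h"
    by (simp add: C1_on_def)
qed

definition lie_f :: "(real^'n) set \<Rightarrow> (real^'n \<Rightarrow> real^'n) \<Rightarrow> (real^'n \<Rightarrow> real) \<Rightarrow> real^'n \<Rightarrow> real" where
  "lie_f D f h x = grad D h x \<bullet> f x"

text \<open>The type \<open>real^'m^'n\<close> is that of matrices with \<open>'n\<close> rows and \<open>'m\<close> columns. The row vector
  \<open>L\<^sub>g h\<close> and its transpose are both represented in \<open>real^'m\<close>.\<close>

definition lie_g :: "(real^'n) set \<Rightarrow> (real^'n \<Rightarrow> real^'m^'n) \<Rightarrow> (real^'n \<Rightarrow> real) \<Rightarrow> real^'n \<Rightarrow> real^'m" where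
  "lie_g D g h x = grad D h x v* g x"

text \<open>Infima and suprema are taken in \<open>ereal\<close> because they may be infinite.\<close>

definition barrier_candidate :: "(real^'n) set \<Rightarrow> (real^'n \<Rightarrow> real) \<Rightarrow> bool" where
  "barrier_candidate D h \<longleftrightarrow>
     C1_on D h \<and> (INF x\<in>D. ereal (h x)) < 0 \<and> 0 < (SUP x\<in>D. ereal (h x))"

definition CBF ::
  "(real^'n) set \<Rightarrow> (real^'n \<Rightarrow> real^'n) \<Rightarrow> (real^'n \<Rightarrow> real^'m^'n) \<Rightarrow> (real^'n \<Rightarrow> real) \<Rightarrow> bool" where
  "CBF D f g h \<longleftrightarrow> C1_on D h \<and>
     (\<exists>\<alpha>. ext_class_K_inf \<alpha> \<and>
       (\<forall>x\<in>D. (SUP u. ereal (lie_f D f h x + lie_g D g h x \<bullet> u)) \<ge> ereal (- \<alpha> (h x))))"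

definition parallel :: "(real^'n) set \<Rightarrow> (real^'n \<Rightarrow> real) \<Rightarrow> (real^'n \<Rightarrow> real) \<Rightarrow> bool" where
  "parallel D h hb \<longleftrightarrow> barrier_candidate D h \<and> barrier_candidate D hb \<and>
     (\<exists>b>0. \<forall>x\<in>D. h x + hb x = b)"

definition safe_set :: "(real^'n) set \<Rightarrow> (real^'n \<Rightarrow> real) \<Rightarrow> (real^'n) set" where
  "safe_set D h = {x \<in> D. h x \<ge> 0}"

definition closed_loop_solution ::
  "(real^'n) set \<Rightarrow> (real^'n \<Rightarrow> real^'n) \<Rightarrow> (real^'n \<Rightarrow> real^'m^'n) \<Rightarrow>
   (real \<Rightarrow> real^'n \<Rightarrow> real^'m) \<Rightarrow> real \<Rightarrow> (real \<Rightarrow> real^'n) \<Rightarrow> bool" where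
  "closed_loop_solution D f g u t0 x \<longleftrightarrow>
     (\<forall>t\<ge>t0. x t \<in> D \<and>
       (x has_vector_derivative (f (x t) + g (x t) *v u t (x t))) (at t within {t0..}))"

definition forward_invariant ::
  "(real^'n) set \<Rightarrow> (real^'n \<Rightarrow> real^'n) \<Rightarrow> (real^'n \<Rightarrow> real^'m^'n) \<Rightarrow>
   (real \<Rightarrow> real^'n \<Rightarrow> real^'m) \<Rightarrow> (real^'n) set \<Rightarrow> bool" where
  "forward_invariant D f g u C \<longleftrightarrow>
     (\<forall>t0 x. closed_loop_solution D f g u t0 x \<longrightarrow> x t0 \<in> C \<longrightarrow> (\<forall>t\<ge>t0. x t \<in> C))"

definition eta_lower ::
  "(real^'n) set \<Rightarrow> (real^'n \<Rightarrow> real^'n) \<Rightarrow> (real^'n \<Rightarrow> real) \<Rightarrow> (real \<Rightarrow> real) \<Rightarrow> real^'n \<Rightarrow> real" where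
  "eta_lower D f h \<alpha> x = - lie_f D f h x - \<alpha> (h x)"

definition eta_upper ::
  "(real^'n) set \<Rightarrow> (real^'n \<Rightarrow> real^'n) \<Rightarrow> (real^'n \<Rightarrow> real) \<Rightarrow> real \<Rightarrow> (real \<Rightarrow> real) \<Rightarrow> real^'n \<Rightarrow> real" where
  "eta_upper D f h b \<alpha>b x = - lie_f D f h x + \<alpha>b (b - h x)"

text \<open>The nominal control \<open>u0\<close> depends on time and state. The cases are read in order; the final
  branch is exactly the case \<open>L\<^sub>g h(x) u\<^sub>0 < \<eta>\<close> for the lower bound \<open>\<eta>\<close>, given that the
  previous ones fail.\<close>

definition control_law ::
  "(real^'n) set \<Rightarrow> (real^'n \<Rightarrow> real^'n) \<Rightarrow> (real^'n \<Rightarrow> real^'m^'n) \<Rightarrow> (real^'n \<Rightarrow> real) \<Rightarrow> real \<Rightarrow>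
   (real \<Rightarrow> real) \<Rightarrow> (real \<Rightarrow> real) \<Rightarrow> (real \<Rightarrow> real^'n \<Rightarrow> real^'m) \<Rightarrow> real \<Rightarrow> real^'n \<Rightarrow> real^'m" where
  "control_law D f g h b \<alpha> \<alpha>b u0 t x =
    (let L = lie_g D g h x; lo = eta_lower D f h \<alpha> x; hi = eta_upper D f h b \<alpha>b x; v = u0 t x in
     if L = 0 then v
     else if lo \<le> L \<bullet> v \<and> L \<bullet> v \<le> hi then v
     else if L \<bullet> v > hi then v + ((hi - L \<bullet> v) / (norm L)\<^sup>2) *\<^sub>R L
     else v + ((lo - L \<bullet> v) / (norm L)\<^sup>2) *\<^sub>R L)"

end

theory Submission
  imports Defs
begin

text \<open>Take \<open>\<alpha>\<close> and \<open>\<alpha>b\<close> to be the class \<open>\<K>\<close> functions that witness that \<open>h\<close> and \<open>hb\<close> are CBFs.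
  Then \<open>h\<close> cannot decrease along a closed-loop solution while \<open>h < 0\<close>, and \<open>hb\<close> cannot decrease
  while \<open>hb < 0\<close>. By the mean value theorem neither function, once nonnegative, can become
  negative (\<open>safe_set_forward_invariant\<close>).

  For the sign of the rates, note that \<open>hb = b - h\<close> on \<open>D\<close>, so the Lie derivatives of \<open>hb\<close> are
  those of \<open>h\<close> with opposite sign. Where \<open>L\<^sub>g h = 0\<close> the control has no influence and both CBF
  conditions bound \<open>L\<^sub>f h\<close>, one from each side. Elsewhere the law places the rate of \<open>h\<close>
  between \<open>- \<alpha> h\<close> and \<open>\<alpha>b (b - h)\<close>, in whichever order these two numbers occur
  (\<open>control_law_rate_bounds\<close>). They are ordered on the safe set. Outside it they may not be, so
  that the interval of the law is empty, but this is harmless: if \<open>h < 0\<close> both numbers are positive, and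
  if \<open>hb < 0\<close>, that is \<open>h > b\<close>, both are negative.\<close>

text \<open>If \<open>\<phi>\<close> were negative at \<open>T\<close>, there would be a last time \<open>s < T\<close> with \<open>\<phi> s \<ge> 0\<close>. After \<open>s\<close>
  the function is negative, hence does not decrease, and the mean value theorem on \<open>{s..T}\<close>
  gives \<open>\<phi> T \<ge> \<phi> s \<ge> 0\<close>.\<close>

lemma nonneg_if_rate_nonneg_where_negative:
  fixes \<phi> \<phi>' :: "real \<Rightarrow> real"
  assumes deriv: "\<And>t. t \<ge> t0 \<Longrightarrow> (\<phi> has_real_derivative \<phi>' t) (at t within {t0..})"
    and start: "\<phi> t0 \<ge> 0"
    and rate: "\<And>t. t \<ge> t0 \<Longrightarrow> \<phi> t < 0 \<Longrightarrow> \<phi>' t \<ge> 0"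
    and T: "T \<ge> t0"
  shows "\<phi> T \<ge> 0"
proof (rule ccontr)
  assume neg: "\<not> \<phi> T \<ge> 0"
  have cont: "continuous_on {t0..T} \<phi>"
    by (rule continuous_on_subset[OF DERIV_continuous_on[of "{t0..}"]]) (use deriv in auto)
  define Z where "Z = {t \<in> {t0..T}. \<phi> t \<ge> 0}"
  have "Z = {t0..T} \<inter> \<phi> -` {0..}"
    by (auto simp: Z_def)
  then have "closed Z"
    using continuous_closed_preimage[OF cont] by simp
  then have "compact Z"
    unfolding compact_eq_bounded_closed
    by (auto intro: bounded_subset[of "{t0..T}"] simp: Z_def)
  moreover have "t0 \<in> Z"
    using start T by (simp add: Z_def)
  ultimately obtain s where s: "s \<in> Z" "\<And>t. t \<in> Z \<Longrightarrow> t \<le> s"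
    using compact_attains_sup[of Z] by auto
  have sT: "t0 \<le> s" "s < T" "\<phi> s \<ge> 0"
    using s(1) neg by (auto simp: Z_def order_less_le)
  have later_neg: "\<phi> t < 0" if "s < t" "t \<le> T" for t
    using s(2)[of t] that sT by (force simp: Z_def)
  have "\<exists>c. s < c \<and> c < T \<and> \<phi> T - \<phi> s = (\<lambda>v. v * \<phi>' c) (T - s)"
  proof (rule mvt[where f' = "\<lambda>t v. v * \<phi>' t", OF sT(2), THEN bexE])
    show "continuous_on {s..T} \<phi>"
      using cont sT by (auto intro: continuous_on_subset)
    show "(\<phi> has_derivative (\<lambda>v. v * \<phi>' t)) (at t)" if "s < t" "t < T" for t
    proof -
      have "at t within {t0..} = at t"
        using that sT by (intro at_within_interior) (simp add: interior_Ici[of "t0 - 1"])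
      then show ?thesis
        using deriv[of t] that sT by (simp add: has_field_derivative_def mult_commute_abs)
    qed
  qed auto
  then obtain c where c: "s < c" "c < T" "\<phi> T - \<phi> s = (T - s) * \<phi>' c"
    by blast
  have "\<phi>' c \<ge> 0"
    using rate[of c] later_neg[of c] c sT by simp
  then show False
    using c(3) sT neg by (smt (verit) mult_nonneg_nonneg)
qed

lemma C1_on_is_grad:
  assumes "C1_on D h" "x \<in> D"
  shows "is_grad D h x (grad D h x)"
  unfolding grad_def by (rule theI') (use assms in \<open>simp add: C1_on_def\<close>)

lemma C1_on_grad_eqI:
  assumes "C1_on D h" "x \<in> D" "is_grad D h x d"
  shows "grad D h x = d"
  unfolding grad_def by (rule the1_equality) (use assms in \<open>auto simp: C1_on_def\<close>)

lemma has_real_derivative_along_solution: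
  assumes C1: "C1_on D h" and sol: "closed_loop_solution D f g u t0 x" and t: "t \<ge> t0"
  shows "((\<lambda>t. h (x t)) has_real_derivative
           lie_f D f h (x t) + lie_g D g h (x t) \<bullet> u t (x t)) (at t within {t0..})"
proof -
  let ?v = "f (x t) + g (x t) *v u t (x t)"
  have x: "x ` {t0..} \<subseteq> D" "(x has_derivative (\<lambda>s. s *\<^sub>R ?v)) (at t within {t0..})"
    using sol t by (auto simp: closed_loop_solution_def has_vector_derivative_def)
  have "(h has_derivative (\<lambda>v. grad D h (x t) \<bullet> v)) (at (x t) within x ` {t0..})"
    using C1_on_is_grad[OF C1, of "x t"] x(1) t
    by (auto simp: is_grad_def intro: has_derivative_subset)
  from has_derivative_in_compose[OF x(2) this] show ?thesis
    by (simp add: has_field_derivative_def lie_f_def lie_g_def dot_lmul_matrix inner_add_right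
        mult_commute_abs)
qed

lemma safe_set_forward_invariant:
  assumes C1: "C1_on D h"
    and rate: "\<And>t x. x \<in> D \<Longrightarrow> h x < 0 \<Longrightarrow> lie_f D f h x + lie_g D g h x \<bullet> u t x \<ge> 0"
  shows "forward_invariant D f g u (safe_set D h)"
  unfolding forward_invariant_def
proof (intro allI impI)
  fix t0 x t
  assume sol: "closed_loop_solution D f g u t0 x" and start: "x t0 \<in> safe_set D h"
    and t: "t0 \<le> t"
  have inD: "x t \<in> D" if "t \<ge> t0" for t
    using sol that by (simp add: closed_loop_solution_def)
  have "h (x t) \<ge> 0"
    by (rule nonneg_if_rate_nonneg_where_negative[
          OF has_real_derivative_along_solution[OF C1 sol] _ _ t])
      (use start rate inD in \<open>auto simp: safe_set_def\<close>)
  then show "x t \<in> safe_set D h"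
    using inD t by (simp add: safe_set_def)
qed

lemma forward_invariant_Int:
  assumes "forward_invariant D f g u A" "forward_invariant D f g u B"
  shows "forward_invariant D f g u (A \<inter> B)"
  using assms by (auto simp: forward_invariant_def)

text \<open>Where \<open>L\<^sub>g h\<close> vanishes, the supremum in the CBF condition is over a constant.\<close>

lemma CBF_obtain:
  assumes "CBF D f g h"
  obtains \<alpha> where "ext_class_K_inf \<alpha>"
    "\<And>x. x \<in> D \<Longrightarrow> lie_g D g h x = 0 \<Longrightarrow> lie_f D f h x \<ge> - \<alpha> (h x)"
proof -
  obtain \<alpha> where \<alpha>: "ext_class_K_inf \<alpha>"
    "\<forall>x\<in>D. (SUP u. ereal (lie_f D f h x + lie_g D g h x \<bullet> u)) \<ge> ereal (- \<alpha> (h x))"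
    using assms by (auto simp: CBF_def)
  have "lie_f D f h x \<ge> - \<alpha> (h x)" if "x \<in> D" "lie_g D g h x = 0" for x
    using bspec[OF \<alpha>(2) that(1)] that(2) by simp
  then show thesis
    using that \<alpha>(1) by blast
qed

lemma grad_parallel:
  assumes "C1_on D h" "C1_on D hb" "x \<in> D" and sum: "\<And>x. x \<in> D \<Longrightarrow> h x + hb x = b"
  shows "grad D hb x = - grad D h x"
proof (rule C1_on_grad_eqI[OF assms(2,3)])
  have "((\<lambda>y. b - h y) has_derivative (\<lambda>v. 0 - grad D h x \<bullet> v)) (at x within D)"
    using C1_on_is_grad[OF assms(1,3)] unfolding is_grad_def by (intro derivative_intros)
  then have "(hb has_derivative (\<lambda>v. 0 - grad D h x \<bullet> v)) (at x within D)"
    by (rule has_derivative_transform[OF assms(3), rotated]) (use sum in \<open>force simp: algebra_simps\<close>)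
  then show "is_grad D hb x (- grad D h x)"
    by (simp add: is_grad_def)
qed

text \<open>Adding a multiple of \<open>L\<^sub>g h\<close> to the nominal control moves \<open>L\<^sub>g h(x) u\<close> exactly onto the
  bound that was violated. Minimum and maximum appear because the two bounds need not be ordered.\<close>

lemma control_law_rate_bounds:
  fixes u0 :: "real \<Rightarrow> real^'n \<Rightarrow> real^'m" and f :: "real^'n \<Rightarrow> real^'n"
    and \<alpha> \<alpha>b :: "real \<Rightarrow> real" and b t :: real
  assumes "lie_g D g h x \<noteq> 0"
  defines "r \<equiv> lie_f D f h x + lie_g D g h x \<bullet> control_law D f g h b \<alpha> \<alpha>b u0 t x"
  shows "min (- \<alpha> (h x)) (\<alpha>b (b - h x)) \<le> r" "r \<le> max (- \<alpha> (h x)) (\<alpha>b (b - h x))"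
proof -
  define L where "L = lie_g D g h x"
  have "(c / (norm L)\<^sup>2) * (L \<bullet> L) = c" for c
    using assms(1) by (simp add: L_def power2_norm_eq_inner)
  then have move: "L \<bullet> (v + ((e - L \<bullet> v) / (norm L)\<^sup>2) *\<^sub>R L) = e" for v e
    by (simp only: inner_add_right inner_scaleR_right)
  show "min (- \<alpha> (h x)) (\<alpha>b (b - h x)) \<le> r" "r \<le> max (- \<alpha> (h x)) (\<alpha>b (b - h x))"
    using assms(1) unfolding r_def control_law_def Let_def L_def[symmetric]
    by (auto simp: move eta_lower_def eta_upper_def simp del: inner_add_right)
qed

lemma ext_class_K_inf_sign:
  assumes "ext_class_K_inf \<alpha>"
  shows "s < 0 \<Longrightarrow> \<alpha> s < 0" "s > 0 \<Longrightarrow> \<alpha> s > 0"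
  using assms strict_monoD[of \<alpha> s 0] strict_monoD[of \<alpha> 0 s] by (auto simp: ext_class_K_inf_def)

theorem theorem2:
  fixes D :: "(real^'n) set"
    and f :: "real^'n \<Rightarrow> real^'n"
    and g :: "real^'n \<Rightarrow> real^'m^'n"
    and h hb :: "real^'n \<Rightarrow> real"
    and b :: real
  assumes "CBF D f g h"
    and "CBF D f g hb"
    and "parallel D h hb"
    and "b > 0"
    and "\<And>x. x \<in> D \<Longrightarrow> h x + hb x = b"
  shows "\<exists>\<alpha> \<alpha>b. ext_class_K_inf \<alpha> \<and> ext_class_K_inf \<alpha>b \<and>
           (\<forall>u0 :: real \<Rightarrow> real^'n \<Rightarrow> real^'m.
              forward_invariant D f g (control_law D f g h b \<alpha> \<alpha>b u0)
                (safe_set D h \<inter> safe_set D hb))"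
proof -
  have C1: "C1_on D h" "C1_on D hb"
    using assms(1,2) by (auto simp: CBF_def)
  obtain \<alpha> where \<alpha>: "ext_class_K_inf \<alpha>"
    and lower: "\<And>x. x \<in> D \<Longrightarrow> lie_g D g h x = 0 \<Longrightarrow> lie_f D f h x \<ge> - \<alpha> (h x)"
    using CBF_obtain[OF assms(1)] by blast
  obtain \<alpha>b where \<alpha>b: "ext_class_K_inf \<alpha>b"
    and upper: "\<And>x. x \<in> D \<Longrightarrow> lie_g D g hb x = 0 \<Longrightarrow> lie_f D f hb x \<ge> - \<alpha>b (hb x)"
    using CBF_obtain[OF assms(2)] by blast
  have "(- w) v* A = - (w v* A)" for w :: "real^'n" and A :: "real^'m^'n"
    by (simp add: vec_eq_iff vector_matrix_mult_def sum_negf)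
  then have lie_hb: "lie_f D f hb x = - lie_f D f h x" "lie_g D g hb x = - lie_g D g h x"
    and hb: "hb x = b - h x" if "x \<in> D" for x
    using grad_parallel[OF C1 that assms(5)] assms(5)[OF that]
    by (auto simp: lie_f_def lie_g_def)
  have "forward_invariant D f g (control_law D f g h b \<alpha> \<alpha>b u0) (safe_set D h \<inter> safe_set D hb)"
    for u0 :: "real \<Rightarrow> real^'n \<Rightarrow> real^'m"
  proof (intro forward_invariant_Int safe_set_forward_invariant C1)
    fix t x assume x: "x \<in> D"
    let ?u = "control_law D f g h b \<alpha> \<alpha>b u0 t x"
    note bounds = control_law_rate_bounds[where f = f and D = D and g = g and h = h and x = x
        and b = b and \<alpha> = \<alpha> and \<alpha>b = \<alpha>b and t = t and ?u0.0 = u0]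
    show "0 \<le> lie_f D f h x + lie_g D g h x \<bullet> ?u" if "h x < 0"
      using lower[OF x] bounds(1) that \<open>b > 0\<close>
        ext_class_K_inf_sign(1)[OF \<alpha>, of "h x"] ext_class_K_inf_sign(2)[OF \<alpha>b, of "b - h x"]
      by (cases "lie_g D g h x = 0") auto
    show "0 \<le> lie_f D f hb x + lie_g D g hb x \<bullet> ?u" if "hb x < 0"
      using upper[OF x] bounds(2) that \<open>b > 0\<close> lie_hb[OF x] hb[OF x]
        ext_class_K_inf_sign(2)[OF \<alpha>, of "h x"] ext_class_K_inf_sign(1)[OF \<alpha>b, of "b - h x"]
      by (cases "lie_g D g h x = 0") auto
  qed
  with \<alpha> \<alpha>b show ?thesis
    by blast
qed

end
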